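(* Let $n\ge 1$ and let $F=(f_1,\dots,f_n):\mathbb{R}^n\to\mathbb{R}^n$ be a locally Lipschitz continuous vector field. Consider the condition $$(P)\qquad \forall i\in\{1,\dots,n\},\ \forall (u_j)_{j\neq i}\in[0,\infty)^{n-1},\quad f_i(u_1,\dots,u_{i-1},0,u_{i+1},\dots,u_n)\ge 0 .$$ (a) Assume $(P)$ and let $U=(u_1,\dots,u_n)\in C^1([0,T_{\max}),\mathbb{R}^n)$ be any maximal positive trajectory of the system $\dot U=F(U)$. If all components of the initial vector $U(0)$ are non-negative, then all components of $U(t)$ are non-negative for all $t\in[0,T_{\max})$. (b) Conversely, if for every maximal positive trajectory $U$ of $\dot U=F(U)$ with all components of $U(0)$ non-negative, all components of $U(t)$ are non-negative for all $t\in[0,T_{\max})$, then $(P)$ holds. (c) In the situation of (a) (that is, assuming $(P)$ and that all components of $U(0)$ are non-negative), for any $j\in\{1,\dots,n\}$ such that $u_j(0)>0$ we have $u_j(t)>0$ for all $t\in[0,T_{\max})$.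
   Context: A maximal positive trajectory of $\dot U=F(U)$ is a solution $U$ defined for forward time on $[0,T_{\max})$, $0<T_{\max}\le\infty$, which cannot be extended to a solution on a larger interval $[0,T')$ with $T'>T_{\max}$; "positive" refers to the time direction. For $n=1$ the condition $(P)$ means $f_1(0)\ge 0$. *)

theory Defs
  imports "HOL-Analysis.Analysis"
begin

text \<open>The final time \<open>T\<close> is an extended real, so that \<open>forward_interval T\<close> is the half-open
  interval from \<open>0\<close> (included) to \<open>T\<close> (excluded), with \<open>T = \<infinity>\<close> allowed.\<close>

definition forward_interval :: "ereal \<Rightarrow> real set"
  where "forward_interval T = {t. 0 \<le> t \<and> ereal t < T}"

text \<open>The function \<open>U\<close> is total in Isabelle, but only its values on \<open>forward_interval T\<close> matter.
  The derivative at time \<open>0\<close> is one-sided. The last conjunct says that the derivative is continuous,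
  i.e. that the solution is \<open>C\<^sup>1\<close>; it is automatic when \<open>F\<close> is continuous.\<close>

definition forward_solution ::
    "('a::real_normed_vector \<Rightarrow> 'a) \<Rightarrow> ereal \<Rightarrow> (real \<Rightarrow> 'a) \<Rightarrow> bool"
  where "forward_solution F T U \<longleftrightarrow>
    0 < T \<and>
    (\<forall>t \<in> forward_interval T.
       (U has_vector_derivative F (U t)) (at t within forward_interval T)) \<and>
    continuous_on (forward_interval T) (\<lambda>t. F (U t))"

definition maximal_positive_trajectory ::
    "('a::real_normed_vector \<Rightarrow> 'a) \<Rightarrow> ereal \<Rightarrow> (real \<Rightarrow> 'a) \<Rightarrow> bool"
  where "maximal_positive_trajectory F T U \<longleftrightarrow>
    forward_solution F T U \<and>
    \<not> (\<exists>T' V. T < T' \<and> forward_solution F T' V \<and> (\<forall>t \<in> forward_interval T. V t = U t))"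

text \<open>The library notion concerns time-dependent maps; the time parameter is a dummy here.\<close>

definition locally_lipschitz :: "('a::metric_space \<Rightarrow> 'b::metric_space) \<Rightarrow> bool"
  where "locally_lipschitz F \<longleftrightarrow> local_lipschitz (UNIV :: real set) UNIV (\<lambda>_. F)"

definition nonneg_components :: "real ^ 'n \<Rightarrow> bool"
  where "nonneg_components u \<longleftrightarrow> (\<forall>i. 0 \<le> u $ i)"

text \<open>The vector \<open>u\<close> encodes the point with \<open>i\<close>-th entry \<open>0\<close> and the other entries
  \<open>u\<^sub>j \<ge> 0\<close>.\<close>

definition condition_P :: "(real ^ 'n \<Rightarrow> real ^ 'n) \<Rightarrow> bool"
  where "condition_P F \<longleftrightarrow>
    (\<forall>i u. u $ i = 0 \<longrightarrow> (\<forall>j. j \<noteq> i \<longrightarrow> 0 \<le> u $ j) \<longrightarrow> 0 \<le> F u $ i)"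

end

theory Submission
  imports Defs
begin

text \<open>Let \<open>v\<close> be the componentwise positive part of a solution \<open>u\<close>. Where \<open>u\<^sub>i < 0\<close>, condition (P) gives
  \<open>f\<^sub>i v \<ge> 0\<close>, so a Lipschitz constant \<open>L\<close> on a ball containing the trajectory yields
  \<open>u\<^sub>i' \<ge> - L * norm (u - v)\<close>. Hence \<open>(norm (u - v))\<^sup>2\<close>, which is \<open>C\<^sup>1\<close> and vanishes initially, stays \<open>0\<close>
  by Gronwall's inequality. Once \<open>u \<ge> 0\<close> is known, comparing \<open>u\<close> with the point where \<open>u\<^sub>j\<close> is
  replaced by \<open>0\<close> gives \<open>u\<^sub>j' \<ge> - L * u\<^sub>j\<close>, so \<open>u\<^sub>j\<close> decays at most exponentially. Conversely, on a
  maximal trajectory issued from a boundary point with \<open>u\<^sub>i = 0\<close>, the difference quotients of \<open>u\<^sub>i\<close>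
  at time \<open>0\<close> are non-negative; such a trajectory exists by the contraction principle and by
  gluing all forward solutions along uniqueness.\<close>

section \<open>Gronwall's inequality and the squared negative part\<close>

text \<open>The integrating factor \<open>exp (- (C * t))\<close> turns the differential inequality
  into monotonicity. Derivatives are taken at interior points only, so the one-sided derivative of a
  solution at time 0 causes no difficulty. The constant \<open>C\<close> may be negative, as in the
  proof of strict positivity.\<close>

lemma gronwall_autonomous:
  fixes g g' :: "real \<Rightarrow> real"
  assumes "0 \<le> b" and cont: "continuous_on {0..b} g"
    and deriv: "\<And>t. 0 < t \<Longrightarrow> t < b \<Longrightarrow> (g has_real_derivative g' t) (at t)"
    and bound: "\<And>t. 0 < t \<Longrightarrow> t < b \<Longrightarrow> g' t \<le> C * g t"
  shows "g b \<le> g 0 * exp (C * b)"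
proof -
  define h where "h t = g t * exp (- (C * t))" for t
  have "h b \<le> h 0"
  proof (rule DERIV_nonpos_imp_decreasing_open[OF \<open>0 \<le> b\<close>])
    fix t assume t: "0 < t" "t < b"
    have "(h has_real_derivative (g' t - C * g t) * exp (- (C * t))) (at t)"
      unfolding h_def by (auto intro!: derivative_eq_intros deriv[OF t] simp: algebra_simps)
    moreover have "(g' t - C * g t) * exp (- (C * t)) \<le> 0"
      using bound[OF t] by (simp add: mult_nonpos_nonneg)
    ultimately show "\<exists>y. (h has_real_derivative y) (at t) \<and> y \<le> 0" by blast
  next
    show "continuous_on {0..b} h"
      unfolding h_def by (intro continuous_intros cont)
  qed
  then show ?thesis by (simp add: h_def exp_minus field_simps)
qed

text \<open>Squaring removes the kink of \<open>min 0 x\<close> at the origin, which makes the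
  squared negative part of a trajectory differentiable in time.\<close>

lemma DERIV_min_0_squared:
  "((\<lambda>x::real. (min 0 x)\<^sup>2) has_real_derivative 2 * min 0 x) (at x)"
proof -
  consider "x < 0" | "x > 0" | "x = 0" by linarith
  then show ?thesis
  proof cases
    case 1
    have "((\<lambda>x::real. x\<^sup>2) has_real_derivative 2 * min 0 x) (at x)"
      using 1 by (auto intro!: derivative_eq_intros)
    then show ?thesis
      by (rule has_field_derivative_transform_within_open[where S="{..<0}"]) (use 1 in auto)
  next
    case 2
    have "((\<lambda>x::real. 0) has_real_derivative 2 * min 0 x) (at x)"
      using 2 by auto
    then show ?thesis
      by (rule has_field_derivative_transform_within_open[where S="{0<..}"]) (use 2 in auto)
  next
    case 3
    \<comment> \<open>At the kink, Caratheodory's criterion applies with slope function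
      \<open>min 0 z\<close>, which is continuous and vanishes there.\<close>
    have "(min 0 z)\<^sup>2 - (min 0 x)\<^sup>2 = min 0 z * (z - x)" for z :: real
      using 3 by (auto simp: min_def power2_eq_square)
    moreover have "isCont (\<lambda>z. min 0 z) x"
      by (intro continuous_intros)
    ultimately show ?thesis
      unfolding CARAT_DERIV using 3 by (intro exI[of _ "\<lambda>z. min 0 z"]) simp
  qed
qed

section \<open>Consequences of local Lipschitz continuity\<close>

lemma locally_lipschitz_imp_continuous_on:
  assumes "locally_lipschitz F" shows "continuous_on S F"
  using local_lipschitz_continuous_on[of UNIV UNIV "\<lambda>_::real. F" 0] assms
  by (auto simp: locally_lipschitz_def intro: continuous_on_subset)

lemma locally_lipschitz_on_compact:
  assumes "locally_lipschitz F" "compact K"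
  obtains L where "L-lipschitz_on K F"
proof -
  \<comment> \<open>The dummy time parameter is restricted to one point, so that the time set is
    compact as well as \<open>K\<close>.\<close>
  have "local_lipschitz {0::real} K (\<lambda>_. F)"
    using assms(1) unfolding locally_lipschitz_def
    by (rule local_lipschitz_subset) auto
  then show ?thesis
    by (rule local_lipschitz_compact_implies_lipschitz) (use assms(2) that in auto)
qed

section \<open>Forward solutions: basic properties and uniqueness\<close>

lemma forward_interval_ereal [simp]: "forward_interval (ereal h) = {0..<h}"
  by (auto simp: forward_interval_def)

lemma zero_mem_forward_interval [simp]: "0 \<in> forward_interval T \<longleftrightarrow> 0 < T"
  by (simp add: forward_interval_def zero_ereal_def)

lemma forward_interval_mono: "T \<le> T' \<Longrightarrow> forward_interval T \<subseteq> forward_interval T'"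
  by (auto simp: forward_interval_def)

lemma atLeastAtMost_subset_forward_interval:
  "b \<in> forward_interval T \<Longrightarrow> {0..b} \<subseteq> forward_interval T"
proof
  fix t assume "b \<in> forward_interval T" "t \<in> {0..b}"
  moreover from this have "ereal t \<le> ereal b" by simp
  ultimately show "t \<in> forward_interval T"
    unfolding forward_interval_def by (auto elim: le_less_trans simp del: ereal_less_eq)
qed

lemma forward_solution_continuous_on:
  assumes "forward_solution F T U" "b \<in> forward_interval T"
  shows "continuous_on {0..b} U"
proof -
  have "continuous_on (forward_interval T) U"
    using assms(1) unfolding forward_solution_def
    by (intro continuous_on_vector_derivative) blast
  then show ?thesis
    by (rule continuous_on_subset) (rule atLeastAtMost_subset_forward_interval[OF assms(2)])
qed

lemma forward_solution_has_vector_derivative: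
  assumes "forward_solution F T U" "b \<in> forward_interval T" "0 < t" "t < b"
  shows "(U has_vector_derivative F (U t)) (at t)"
proof -
  have "t \<in> forward_interval T"
    using atLeastAtMost_subset_forward_interval[OF assms(2)] assms by auto
  then have "(U has_vector_derivative F (U t)) (at t within forward_interval T)"
    using assms(1) unfolding forward_solution_def by blast
  \<comment> \<open>Relative to an open interval around \<open>t\<close>, the derivative is
    two-sided.\<close>
  then have "(U has_vector_derivative F (U t)) (at t within {0<..<b})"
    by (rule has_vector_derivative_within_subset)
       (use atLeastAtMost_subset_forward_interval[OF assms(2)] in auto)
  then show ?thesis
    using assms by (simp add: at_within_open[of t "{0<..<b}"])
qed

lemma forward_solution_bounded:
  assumes "forward_solution F T U" "b \<in> forward_interval T"
  obtains R where "\<And>t. t \<in> {0..b} \<Longrightarrow> norm (U t) \<le> R"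
proof -
  have "bounded (U ` {0..b})"
    by (intro compact_imp_bounded compact_continuous_image forward_solution_continuous_on[OF assms])
      simp
  then show ?thesis using that unfolding bounded_iff by blast
qed

text \<open>Both curves stay in a common ball up to time \<open>b\<close>, where one Lipschitz
  constant serves, and Gronwall applies to their squared distance. The lifespans \<open>T\<close>
  and \<open>T'\<close> may differ, as the later gluing requires.\<close>

lemma forward_solution_unique:
  fixes F :: "'a::euclidean_space \<Rightarrow> 'a"
  assumes F: "locally_lipschitz F"
    and U: "forward_solution F T U" "b \<in> forward_interval T"
    and V: "forward_solution F T' V" "b \<in> forward_interval T'"
    and "U 0 = V 0"
  shows "U b = V b"
proof -
  obtain R where R: "\<And>t. t \<in> {0..b} \<Longrightarrow> norm (U t) \<le> R"
    using forward_solution_bounded[OF U] by blast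
  obtain R' where R': "\<And>t. t \<in> {0..b} \<Longrightarrow> norm (V t) \<le> R'"
    using forward_solution_bounded[OF V] by blast
  obtain L where L: "L-lipschitz_on (cball 0 (max R R')) F"
    using locally_lipschitz_on_compact[OF F compact_cball] by blast
  \<comment> \<open>The squared distance, unlike the distance, is differentiable even where the
    curves meet.\<close>
  define g where "g t = (U t - V t) \<bullet> (U t - V t)" for t
  have "0 \<le> b" using U(2) by (simp add: forward_interval_def)
  then have "g b \<le> g 0 * exp ((2 * L) * b)"
  proof (rule gronwall_autonomous)
    show "continuous_on {0..b} g"
      unfolding g_def
      by (intro continuous_intros forward_solution_continuous_on[OF U]
          forward_solution_continuous_on[OF V])
  next
    fix t assume t: "0 < t" "t < b"
    show "(g has_real_derivative 2 * ((U t - V t) \<bullet> (F (U t) - F (V t)))) (at t)"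
      using forward_solution_has_vector_derivative[OF U t]
        forward_solution_has_vector_derivative[OF V t]
      unfolding g_def has_real_derivative_iff_has_vector_derivative has_vector_derivative_def
      by (auto intro!: derivative_eq_intros simp: algebra_simps inner_commute)
    have "U t \<in> cball 0 (max R R')" "V t \<in> cball 0 (max R R')"
      using R[of t] R'[of t] t by auto
    then have "norm (F (U t) - F (V t)) \<le> L * norm (U t - V t)"
      by (rule lipschitz_on_normD[OF L])
    then have "(U t - V t) \<bullet> (F (U t) - F (V t)) \<le> norm (U t - V t) * (L * norm (U t - V t))"
      by (meson norm_cauchy_schwarz mult_left_mono norm_ge_zero order_trans)
    then show "2 * ((U t - V t) \<bullet> (F (U t) - F (V t))) \<le> 2 * L * g t"
      by (simp add: g_def dot_square_norm power2_eq_square algebra_simps)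
  qed
  then have "(U b - V b) \<bullet> (U b - V b) \<le> 0"
    using \<open>U 0 = V 0\<close> by (simp add: g_def)
  then show ?thesis using inner_ge_zero[of "U b - V b"] by (simp add: order_antisym)
qed

section \<open>Existence of local solutions and of maximal trajectories\<close>

text \<open>Picard iteration: a fixed point of the integral operator solves the equation on a short
  interval.\<close>

lemma forward_solution_exists:
  fixes F :: "'a::euclidean_space \<Rightarrow> 'a"
  assumes F: "locally_lipschitz F"
  obtains T U where "forward_solution F T U" "U 0 = u"
proof -
  have contF: "continuous_on S F" for S
    using F by (rule locally_lipschitz_imp_continuous_on)
  obtain L where L: "L-lipschitz_on (cball u 1) F"
    using locally_lipschitz_on_compact[OF F compact_cball] by blast
  then have "0 \<le> L" by (rule lipschitz_on_nonneg)
  have "bounded (F ` cball u 1)"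
    by (intro compact_imp_bounded compact_continuous_image contF compact_cball)
  then obtain B where B: "0 < B" "\<And>x. x \<in> cball u 1 \<Longrightarrow> norm (F x) \<le> B"
    by (auto simp: bounded_pos)
  \<comment> \<open>The bound \<open>B * h \<le> 1\<close> keeps the Picard iterates in the unit
    ball around \<open>u\<close>, and \<open>L * h \<le> 1 / 2\<close> makes the operator a
    contraction.\<close>
  define h where "h = 1 / (2 * (1 + L + B))"
  have h: "0 < h" "B * h \<le> 1" "L * h \<le> 1 / 2"
    using \<open>0 \<le> L\<close> \<open>0 < B\<close> by (auto simp: h_def field_simps)
  have contFy: "continuous_on S (\<lambda>s. F (apply_bcontfun y s))" for y S
    by (rule continuous_on_compose2[OF contF[of UNIV]]) auto
  \<comment> \<open>The Banach space used consists of bounded continuous maps on the whole line.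
    Clamping the upper limit to \<open>{0..h}\<close> extends the Picard integral by constants to
    such a map.\<close>
  have "\<exists>g::real \<Rightarrow>\<^sub>C 'a. \<forall>t. g t = u + integral {0..clamp 0 h t} (\<lambda>s. F (apply_bcontfun y s))" for y
  proof -
    have "continuous_on (cbox 0 h) (\<lambda>t. u + integral {0..t} (\<lambda>s. F (apply_bcontfun y s)))"
      unfolding box_real
      by (intro continuous_intros indefinite_integral_continuous_1 integrable_continuous_real contFy)
    then show ?thesis
      by (rule continuous_on_cbox_bcontfunE) blast
  qed
  then obtain P :: "(real \<Rightarrow>\<^sub>C 'a) \<Rightarrow> (real \<Rightarrow>\<^sub>C 'a)" where
    P: "\<And>y t. P y t = u + integral {0..clamp 0 h t} (\<lambda>s. F (apply_bcontfun y s))"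
    by metis
  have clamp: "clamp 0 h t \<in> {0..h}" for t
    using clamp_in_interval[of 0 h t] h by simp
  define S where "S = PiC (UNIV :: real set) (\<lambda>_. cball u 1)"
  have S: "y \<in> S \<longleftrightarrow> (\<forall>t. apply_bcontfun y t \<in> cball u 1)" for y
    by (auto simp: S_def mem_PiC_iff)
  have "\<exists>!y\<in>S. P y = y"
  proof (rule Banach_fix)
    show "complete S"
      unfolding complete_eq_closed S_def by (intro closed_PiC closed_cball)
    have "const_bcontfun u \<in> S" by (simp add: S const_bcontfun.rep_eq)
    then show "S \<noteq> {}" by blast
    show "0 \<le> (1/2::real)" "(1/2::real) < 1" by simp_all
    show "P ` S \<subseteq> S"
    proof safe
      fix y assume y: "y \<in> S"
      have "dist u (P y t) \<le> 1" for t
      proof -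
        have "norm (integral {0..clamp 0 h t} (\<lambda>s. F (apply_bcontfun y s))) \<le> B * (clamp 0 h t - 0)"
          by (rule integral_bound) (use clamp[of t] y in \<open>auto intro!: contFy B simp: S\<close>)
        also have "\<dots> \<le> B * h" using clamp[of t] \<open>0 < B\<close> by simp
        finally show ?thesis using h by (simp add: P dist_norm)
      qed
      then show "P y \<in> S" by (simp add: S)
    qed
    fix y z assume yz: "y \<in> S" "z \<in> S"
    show "dist (P y) (P z) \<le> 1/2 * dist y z"
    proof (rule dist_bound)
      fix t
      have "dist (P y t) (P z t) =
          norm (integral {0..clamp 0 h t} (\<lambda>s. F (apply_bcontfun y s) - F (apply_bcontfun z s)))"
        by (simp add: P dist_norm integral_diff integrable_continuous_real contFy)
      also have "\<dots> \<le> (L * dist y z) * (clamp 0 h t - 0)"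
      proof (rule integral_bound)
        fix s
        have "norm (F (y s) - F (z s)) \<le> L * norm (y s - z s)"
          by (rule lipschitz_on_normD[OF L]) (use yz in \<open>auto simp: S\<close>)
        also have "\<dots> \<le> L * dist y z"
          using dist_bounded[of y s z] \<open>0 \<le> L\<close> by (simp add: dist_norm mult_left_mono)
        finally show "norm (F (y s) - F (z s)) \<le> L * dist y z" .
      qed (use clamp[of t] in \<open>auto intro!: continuous_intros contFy\<close>)
      also have "\<dots> \<le> (L * dist y z) * h"
        using clamp[of t] \<open>0 \<le> L\<close> by (intro mult_left_mono) auto
      also have "\<dots> \<le> 1/2 * dist y z"
        using mult_right_mono[OF h(3), of "dist y z"] by (simp add: algebra_simps)
      finally show "dist (P y t) (P z t) \<le> 1/2 * dist y z" .
    qed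
  qed
  then obtain y where y: "P y = y" by blast
  \<comment> \<open>On \<open>{0..h}\<close> clamping is the identity, so the fixed point satisfies
    the true integral equation there.\<close>
  have y_eq: "apply_bcontfun y t = u + integral {0..t} (\<lambda>s. F (apply_bcontfun y s))"
    if "t \<in> {0..h}" for t
    using P[of y t] clamp_cancel_cbox[of t 0 h] that by (simp add: y)
  have "forward_solution F (ereal h) (apply_bcontfun y)"
    unfolding forward_solution_def forward_interval_ereal
  proof (intro conjI ballI contFy)
    show "0 < ereal h" using h by simp
    fix t assume t: "t \<in> {0..<h}"
    have "((\<lambda>t. u + integral {0..t} (\<lambda>s. F (apply_bcontfun y s)))
        has_vector_derivative 0 + F (y t)) (at t within {0..h})"
      using t by (intro has_vector_derivative_add has_vector_derivative_const
          integral_has_vector_derivative contFy) auto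
    then have "((\<lambda>t. u + integral {0..t} (\<lambda>s. F (apply_bcontfun y s)))
        has_vector_derivative F (y t)) (at t within {0..<h})"
      by (auto elim: has_vector_derivative_within_subset)
    then show "(apply_bcontfun y has_vector_derivative F (y t)) (at t within {0..<h})"
      by (rule has_vector_derivative_transform[rotated 2]) (use t y_eq in auto)
  qed
  moreover have "apply_bcontfun y 0 = u" using y_eq[of 0] h by simp
  ultimately show ?thesis by (rule that)
qed

text \<open>The lifespan is the supremum of the lifespans of all solutions starting at
  \<open>u\<close>. Uniqueness makes these solutions agree wherever two of them are defined, so they
  glue to one solution up to the supremum.\<close>

lemma maximal_positive_trajectory_exists:
  fixes F :: "'a::euclidean_space \<Rightarrow> 'a"
  assumes F: "locally_lipschitz F"
  obtains T U where "maximal_positive_trajectory F T U" "U 0 = u"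
proof -
  define A where "A = {T. \<exists>U. forward_solution F T U \<and> U 0 = u}"
  have "\<forall>T\<in>A. \<exists>U. forward_solution F T U \<and> U 0 = u" by (simp add: A_def)
  from bchoice[OF this] obtain W
    where W: "\<And>T. T \<in> A \<Longrightarrow> forward_solution F T (W T) \<and> W T 0 = u"
    by blast
  obtain T\<^sub>0 where T\<^sub>0: "T\<^sub>0 \<in> A"
    by (rule forward_solution_exists[OF F, of u]) (auto simp: A_def)
  then have T\<^sub>0_pos: "0 < T\<^sub>0" using W by (auto simp: forward_solution_def)
  define T where "T = Sup A"
  have le_T: "S \<le> T" if "S \<in> A" for S
    using that by (simp add: T_def Sup_upper)
  have T_pos: "0 < T" using T\<^sub>0_pos le_T[OF T\<^sub>0] by simp
  have "\<exists>S. S \<in> A \<and> t \<in> forward_interval S" if "t \<in> forward_interval T" for t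
    using that by (auto simp: forward_interval_def T_def less_Sup_iff)
  then obtain \<tau> where \<tau>: "\<And>t. t \<in> forward_interval T \<Longrightarrow> \<tau> t \<in> A \<and> t \<in> forward_interval (\<tau> t)"
    by metis
  \<comment> \<open>The value at \<open>t\<close> is read off a chosen solution still alive at
    \<open>t\<close>; \<open>U_eq\<close> shows that the choice does not matter.\<close>
  define U where "U t = W (\<tau> t) t" for t
  have U_eq: "U t = W S t" if "S \<in> A" "t \<in> forward_interval S" for S t
  proof -
    have "t \<in> forward_interval T" using that forward_interval_mono[OF le_T[OF that(1)]] by auto
    then have \<tau>t: "\<tau> t \<in> A" "t \<in> forward_interval (\<tau> t)" using \<tau> by auto
    have "W (\<tau> t) t = W S t"
      by (rule forward_solution_unique[OF F, of "\<tau> t" _ _ S])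
         (simp_all add: W \<tau>t that)
    then show ?thesis by (simp add: U_def)
  qed
  have "0 \<in> forward_interval T\<^sub>0" using T\<^sub>0_pos by simp
  then have U0: "U 0 = u" using U_eq[OF T\<^sub>0] W[OF T\<^sub>0] by simp
  have deriv: "(U has_vector_derivative F (U t)) (at t within forward_interval T)"
    if t: "t \<in> forward_interval T" for t
  proof -
    define S where "S = \<tau> t"
    have S: "S \<in> A" "t \<in> forward_interval S" using \<tau>[OF t] by (auto simp: S_def)
    then have "ereal t < S" by (simp add: forward_interval_def)
    then obtain r where r: "ereal t < ereal r" "ereal r < S"
      using ereal_dense2 by blast
    have dist_imp: "x \<in> forward_interval S" if "x \<in> forward_interval T" "dist x t < r - t" for x
    proof -
      have "ereal x < ereal r" using that by (simp add: dist_real_def)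
      with r have "ereal x < S" by (meson less_trans)
      with that show ?thesis by (simp add: forward_interval_def)
    qed
    have "(W S has_vector_derivative F (W S t)) (at t within forward_interval S)"
      using W[OF S(1)] S(2) by (simp add: forward_solution_def)
    \<comment> \<open>Since \<open>t < r < S\<close>, the two intervals have the same points within
      distance \<open>r - t\<close> of \<open>t\<close>, so derivatives relative to them coincide,
      including at time 0.\<close>
    moreover have "at t within forward_interval S = at t within forward_interval T"
    proof (rule at_within_nhd[of t "ball t (r - t)"])
      show "forward_interval S \<inter> ball t (r - t) - {t} = forward_interval T \<inter> ball t (r - t) - {t}"
        using dist_imp forward_interval_mono[OF le_T[OF S(1)]] by (auto simp: dist_commute)
    qed (use r in auto)
    ultimately have "(W S has_vector_derivative F (U t)) (at t within forward_interval T)"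
      using U_eq[OF S] by simp
    then show ?thesis
      by (rule has_vector_derivative_transform_within[where d="r - t"])
         (use r t U_eq[OF S(1)] dist_imp in auto)
  qed
  have "continuous_on (forward_interval T) (\<lambda>t. F (U t))"
    by (rule continuous_on_compose2[OF locally_lipschitz_imp_continuous_on[OF F, of UNIV]])
       (auto intro: continuous_on_vector_derivative deriv)
  then have sol: "forward_solution F T U"
    using T_pos deriv by (simp add: forward_solution_def)
  \<comment> \<open>A proper extension would again start at \<open>u\<close>, so its lifespan would
    lie in \<open>A\<close> and exceed the supremum.\<close>
  have "\<not> (T < T' \<and> forward_solution F T' V \<and> (\<forall>t\<in>forward_interval T. V t = U t))" for T' V
  proof
    assume *: "T < T' \<and> forward_solution F T' V \<and> (\<forall>t\<in>forward_interval T. V t = U t)"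
    moreover have "0 \<in> forward_interval T" using T_pos by simp
    ultimately have "T' \<in> A" using U0 by (auto simp: A_def)
    then show False using le_T * by fastforce
  qed
  with sol have "maximal_positive_trajectory F T U"
    unfolding maximal_positive_trajectory_def by blast
  then show ?thesis using U0 by (rule that)
qed

section \<open>Condition (P) preserves non-negativity and strict positivity\<close>

lemma condition_P_imp_nonneg:
  fixes F :: "real ^ 'n \<Rightarrow> real ^ 'n"
  assumes F: "locally_lipschitz F" and P: "condition_P F"
    and U: "forward_solution F T U" "b \<in> forward_interval T"
    and "nonneg_components (U 0)"
  shows "nonneg_components (U b)"
proof -
  obtain R where R: "\<And>t. t \<in> {0..b} \<Longrightarrow> norm (U t) \<le> R"
    using forward_solution_bounded[OF U] by blast
  obtain L where L: "L-lipschitz_on (cball 0 R) F"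
    using locally_lipschitz_on_compact[OF F compact_cball] by blast
  then have "0 \<le> L" by (rule lipschitz_on_nonneg)
  \<comment> \<open>Subtracting \<open>m x\<close> from \<open>x\<close> leaves the componentwise
    positive part, so \<open>g\<close> below is the squared distance of the trajectory from the
    non-negative orthant.\<close>
  define m :: "real ^ 'n \<Rightarrow> real ^ 'n" where "m x = (\<chi> i. min 0 (x $ i))" for x
  define g where "g t = (\<Sum>i\<in>UNIV. (min 0 (U t $ i))\<^sup>2)" for t
  have g: "g t = (norm (m (U t)))\<^sup>2" for t
    by (simp add: g_def m_def norm_vec_def L2_set_def sum_nonneg)
  have "0 \<le> b" using U(2) by (simp add: forward_interval_def)
  \<comment> \<open>Each of the \<open>CARD('n)\<close> summands of the derivative is bounded
    crudely by \<open>2 * L * g t\<close>, which gives the constant.\<close>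
  then have "g b \<le> g 0 * exp ((2 * L * real CARD('n)) * b)"
  proof (rule gronwall_autonomous)
    show "continuous_on {0..b} g"
      unfolding g_def by (intro continuous_intros forward_solution_continuous_on[OF U])
  next
    fix t assume t: "0 < t" "t < b"
    have "((\<lambda>t. U t $ i) has_real_derivative F (U t) $ i) (at t)" for i
      using bounded_linear.has_vector_derivative[OF bounded_linear_vec_nth
          forward_solution_has_vector_derivative[OF U t]]
      by (simp add: has_real_derivative_iff_has_vector_derivative)
    from DERIV_chain2[OF DERIV_min_0_squared this]
    show "(g has_real_derivative (\<Sum>i\<in>UNIV. 2 * min 0 (U t $ i) * F (U t) $ i)) (at t)"
      unfolding g_def by (intro DERIV_sum)
    have "2 * min 0 (U t $ i) * F (U t) $ i \<le> 2 * L * g t" for i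
    proof (cases "U t $ i < 0")
      case True
      \<comment> \<open>As the \<open>i\<close>-th entry of \<open>U t\<close> is negative, that of
        \<open>v\<close> is 0, so (P) applies at \<open>v\<close>.\<close>
      define v where "v = U t - m (U t)"
      have v: "v $ j = max 0 (U t $ j)" for j
        by (simp add: v_def m_def)
      have "0 \<le> F v $ i"
        using P True unfolding condition_P_def by (simp add: v)
      moreover have "norm (F (U t) - F v) \<le> L * norm (U t - v)"
      proof (rule lipschitz_on_normD[OF L])
        show "U t \<in> cball 0 R" using R[of t] t by simp
        \<comment> \<open>Taking positive parts does not increase the norm, so \<open>L\<close> is
          valid at \<open>v\<close> too.\<close>
        moreover have "norm v \<le> norm (U t)"
          by (rule norm_le_componentwise_cart) (simp add: v)
        ultimately show "v \<in> cball 0 R" by simp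
      qed
      moreover have "\<bar>F (U t) $ i - F v $ i\<bar> \<le> norm (F (U t) - F v)"
        using component_le_norm_cart[of "F (U t) - F v" i] by simp
      ultimately have "- F (U t) $ i \<le> L * norm (m (U t))"
        by (simp add: v_def)
      then have "(- (U t $ i)) * (- F (U t) $ i) \<le> (- (U t $ i)) * (L * norm (m (U t)))"
        using True by (intro mult_left_mono) auto
      also have "- (U t $ i) \<le> norm (m (U t))"
        using component_le_norm_cart[of "m (U t)" i] True by (simp add: m_def)
      then have "(- (U t $ i)) * (L * norm (m (U t))) \<le> norm (m (U t)) * (L * norm (m (U t)))"
        using \<open>0 \<le> L\<close> by (intro mult_right_mono) auto
      finally show ?thesis using True by (simp add: g power2_eq_square algebra_simps)
    qed (use \<open>0 \<le> L\<close> in \<open>simp add: g\<close>)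
    then have "(\<Sum>i\<in>UNIV. 2 * min 0 (U t $ i) * F (U t) $ i) \<le> (\<Sum>i\<in>(UNIV::'n set). 2 * L * g t)"
      by (intro sum_mono)
    then show "(\<Sum>i\<in>UNIV. 2 * min 0 (U t $ i) * F (U t) $ i) \<le> 2 * L * real CARD('n) * g t"
      by (simp add: algebra_simps)
  qed
  moreover have "g 0 = 0"
    using \<open>nonneg_components (U 0)\<close> by (simp add: g_def nonneg_components_def)
  ultimately have "m (U b) = 0" by (simp add: g)
  then have "min 0 (U b $ i) = 0" for i by (simp add: m_def vec_eq_iff)
  then show ?thesis unfolding nonneg_components_def by (metis min.cobounded2)
qed

lemma condition_P_imp_pos:
  fixes F :: "real ^ 'n \<Rightarrow> real ^ 'n"
  assumes F: "locally_lipschitz F" and P: "condition_P F"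
    and U: "forward_solution F T U" "b \<in> forward_interval T"
    and U0: "nonneg_components (U 0)" "0 < U 0 $ j"
  shows "0 < U b $ j"
proof -
  obtain R where R: "\<And>t. t \<in> {0..b} \<Longrightarrow> norm (U t) \<le> R"
    using forward_solution_bounded[OF U] by blast
  obtain L where L: "L-lipschitz_on (cball 0 R) F"
    using locally_lipschitz_on_compact[OF F compact_cball] by blast
  have "0 \<le> b" using U(2) by (simp add: forward_interval_def)
  \<comment> \<open>Gronwall gives upper bounds, so it is applied to the negated component, with
    constant \<open>- L\<close>, to bound the component from below.\<close>
  then have "- (U b $ j) \<le> - (U 0 $ j) * exp (- L * b)"
  proof (rule gronwall_autonomous)
    show "continuous_on {0..b} (\<lambda>t. - (U t $ j))"
      by (intro continuous_intros forward_solution_continuous_on[OF U])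
  next
    fix t assume t: "0 < t" "t < b"
    have "((\<lambda>t. U t $ j) has_real_derivative F (U t) $ j) (at t)"
      using bounded_linear.has_vector_derivative[OF bounded_linear_vec_nth
          forward_solution_has_vector_derivative[OF U t]]
      by (simp add: has_real_derivative_iff_has_vector_derivative)
    then show "((\<lambda>t. - (U t $ j)) has_real_derivative - (F (U t) $ j)) (at t)"
      by (rule DERIV_minus)
    have "t \<in> forward_interval T"
      using atLeastAtMost_subset_forward_interval[OF U(2)] t by auto
    then have nonneg: "0 \<le> U t $ i" for i
      using condition_P_imp_nonneg[OF F P U(1) _ U0(1)] by (simp add: nonneg_components_def)
    \<comment> \<open>Only entry \<open>j\<close> is set to 0, so \<open>v\<close> is at distance
      exactly \<open>U t $ j\<close> from \<open>U t\<close>, and non-negativity of the other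
      entries makes (P) applicable.\<close>
    define v :: "real ^ 'n" where "v = (\<chi> i. if i = j then 0 else U t $ i)"
    have "0 \<le> F v $ j"
      using P nonneg unfolding condition_P_def by (simp add: v_def)
    moreover have "norm (F (U t) - F v) \<le> L * norm (U t - v)"
    proof (rule lipschitz_on_normD[OF L])
      show "U t \<in> cball 0 R" using R[of t] t by simp
      moreover have "norm v \<le> norm (U t)"
        by (rule norm_le_componentwise_cart) (simp add: v_def)
      ultimately show "v \<in> cball 0 R" by simp
    qed
    moreover have "U t - v = (U t $ j) *\<^sub>R axis j 1"
      by (auto simp: vec_eq_iff v_def axis_def)
    moreover have "\<bar>F (U t) $ j - F v $ j\<bar> \<le> norm (F (U t) - F v)"
      using component_le_norm_cart[of "F (U t) - F v" j] by simp
    ultimately show "- (F (U t) $ j) \<le> - L * - (U t $ j)"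
      using nonneg[of j] by (simp add: norm_axis_1)
  qed
  moreover have "0 < U 0 $ j * exp (- L * b)" using U0(2) by simp
  ultimately show ?thesis by simp
qed

section \<open>Necessity of condition (P)\<close>

text \<open>Existence of a maximal trajectory from every boundary point keeps the hypothesis from
  being vacuous there; its velocity at time 0 is the value of \<open>F\<close> to be tested.\<close>

lemma nonneg_imp_condition_P:
  fixes F :: "real ^ 'n \<Rightarrow> real ^ 'n"
  assumes F: "locally_lipschitz F"
    and nonneg: "\<And>T U t. maximal_positive_trajectory F T U \<Longrightarrow> nonneg_components (U 0) \<Longrightarrow>
      t \<in> forward_interval T \<Longrightarrow> nonneg_components (U t)"
  shows "condition_P F"
  unfolding condition_P_def
proof (intro allI impI)
  fix i and u :: "real ^ 'n"
  assume u: "u $ i = 0" "\<forall>j. j \<noteq> i \<longrightarrow> 0 \<le> u $ j"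
  obtain T U where U: "maximal_positive_trajectory F T U" "U 0 = u"
    using maximal_positive_trajectory_exists[OF F] by blast
  then have sol: "forward_solution F T U" by (simp add: maximal_positive_trajectory_def)
  then have "0 < T" by (simp add: forward_solution_def)
  then obtain b where b: "0 < ereal b" "ereal b < T"
    using ereal_dense2[of 0 T] by blast
  then have b': "b \<in> forward_interval T" "0 < b" by (auto simp: forward_interval_def)
  have "0 \<in> forward_interval T" using \<open>0 < T\<close> by simp
  then have "(U has_vector_derivative F u) (at 0 within forward_interval T)"
    using sol U(2) by (auto simp: forward_solution_def)
  then have "(U has_vector_derivative F u) (at 0 within {0..b})"
    using atLeastAtMost_subset_forward_interval[OF b'(1)]
    by (rule has_vector_derivative_within_subset)
  from bounded_linear.has_vector_derivative[OF bounded_linear_vec_nth[of i] this]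
  have deriv: "((\<lambda>t. U t $ i) has_real_derivative F u $ i) (at 0 within {0..b})"
    by (simp add: has_real_derivative_iff_has_vector_derivative)
  have "nonneg_components (U 0)"
    using u U(2) unfolding nonneg_components_def by (metis order_refl)
  then have nn: "0 \<le> U t $ i" if "t \<in> {0..b}" for t
    using nonneg[OF U(1)] atLeastAtMost_subset_forward_interval[OF b'(1)] that
    by (auto simp: nonneg_components_def)
  show "0 \<le> F u $ i"
  proof (rule tendsto_lowerbound)
    show "((\<lambda>t. (U t $ i - U 0 $ i) / (t - 0)) \<longlongrightarrow> F u $ i) (at 0 within {0..b})"
      using deriv by (simp only: has_field_derivative_iff)
    \<comment> \<open>The \<open>i\<close>-th component starts at 0 and stays non-negative, and only
      \<open>t > 0\<close> is approached within \<open>{0..b}\<close>.\<close>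
    show "\<forall>\<^sub>F t in at 0 within {0..b}. 0 \<le> (U t $ i - U 0 $ i) / (t - 0)"
      using nn u U(2) by (auto simp: eventually_at_filter)
    show "at 0 within {0..b} \<noteq> bot"
      using b'(2) by (simp add: trivial_limit_within)
  qed
qed

theorem theorem2p4:
  fixes F :: "real ^ 'n \<Rightarrow> real ^ 'n"
  assumes "locally_lipschitz F"
  shows
    "(condition_P F \<longrightarrow>
       (\<forall>T U. maximal_positive_trajectory F T U \<longrightarrow> nonneg_components (U 0) \<longrightarrow>
          (\<forall>t \<in> forward_interval T. nonneg_components (U t)))) \<and>
     ((\<forall>T U. maximal_positive_trajectory F T U \<longrightarrow> nonneg_components (U 0) \<longrightarrow>
          (\<forall>t \<in> forward_interval T. nonneg_components (U t))) \<longrightarrow>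
       condition_P F) \<and>
     (condition_P F \<longrightarrow>
       (\<forall>T U. maximal_positive_trajectory F T U \<longrightarrow> nonneg_components (U 0) \<longrightarrow>
          (\<forall>j. 0 < U 0 $ j \<longrightarrow> (\<forall>t \<in> forward_interval T. 0 < U t $ j))))"
  using condition_P_imp_nonneg[OF assms] condition_P_imp_pos[OF assms]
    nonneg_imp_condition_P[OF assms]
  unfolding maximal_positive_trajectory_def by blast

end
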